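(* Let $0<q<p$, let $r,s\ge 0$ be integers, let $a_{ip},a_{iq}$ ($1\le i\le r$) and $b_{jp},b_{jq}$ ($1\le j\le s$) be nonzero complex numbers with $b_{jp}p^k\neq b_{jq}q^k$ for all $k\ge 0$ and all $j$, and let $z\in\mathbb{C}$, $|z|<1$. Put $$\mu=\frac{b_{1p}b_{2p}\cdots b_{sp}\,p}{a_{1p}a_{2p}\cdots a_{rp}}.$$ Assume that the series ${}_r\phi_s\left(\frac{a_{1q}}{a_{1p}},\dots,\frac{a_{rq}}{a_{rp}};\frac{b_{1q}}{b_{1p}},\dots,\frac{b_{sq}}{b_{sp}};\frac{q}{p},z\right)$ converges or terminates. Then it is equal to (i) if $s=r-1$: ${}_r\Phi_s\big((a_{1p},a_{1q}),\dots,(a_{rp},a_{rq});(b_{1p},b_{1q}),\dots,(b_{sp},b_{sq});(p,q),\mu z\big)$; (ii) if $s>r-1$: ${}_{s+1}\Phi_s\big((a_{1p},a_{1q}),\dots,(a_{rp},a_{rq}),(0,1),\dots,(0,1);(b_{1p},b_{1q}),\dots,(b_{sp},b_{sq});(p,q),\mu z\big)$, where the pair $(0,1)$ is inserted $s+1-r$ times; (iii) if $s<r-1$: ${}_r\Phi_{r-1}\big((a_{1p},a_{1q}),\dots,(a_{rp},a_{rq});(b_{1p},b_{1q}),\dots,(b_{sp},b_{sq}),(0,1),\dots,(0,1);(p,q),\mu z\big)$, where the pair $(0,1)$ is inserted $r-1-s$ times.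
   Context: For $n\ge 0$, $(a;q)_n=\prod_{i=0}^{n-1}(1-aq^i)$ and $((a,b);(p,q))_n=\prod_{i=0}^{n-1}(ap^i-bq^i)$ (empty products equal $1$). The basic hypergeometric series is $${}_r\phi_s(a_1,\dots,a_r;b_1,\dots,b_s;q,z)=\sum_{n=0}^\infty\frac{(a_1;q)_n\cdots(a_r;q)_n}{(b_1;q)_n\cdots(b_s;q)_n\,(q;q)_n}\left((-1)^nq^{n(n-1)/2}\right)^{1+s-r}z^n.$$ The twin-basic, or $(p,q)$-, hypergeometric series is $${}_r\Phi_s\big((a_{1p},a_{1q}),\dots,(a_{rp},a_{rq});(b_{1p},b_{1q}),\dots,(b_{sp},b_{sq});(p,q),z\big)=\sum_{n=0}^\infty\frac{\prod_{i=1}^r((a_{ip},a_{iq});(p,q))_n}{\prod_{j=1}^s((b_{jp},b_{jq});(p,q))_n\;((p,q);(p,q))_n}\left((-1)^n(q/p)^{n(n-1)/2}\right)^{1+s-r}z^n.$$ In these notations $a_{ip},a_{iq},b_{jp},b_{jq}$ are just names of independent parameters (the letters $p,q$ in the subscripts are labels). *)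

theory Defs
  imports Complex_Main
begin

definition q_poch :: "complex \<Rightarrow> complex \<Rightarrow> nat \<Rightarrow> complex" where
  "q_poch a q n = (\<Prod>i<n. 1 - a * q ^ i)"

definition pq_poch :: "complex \<times> complex \<Rightarrow> complex \<Rightarrow> complex \<Rightarrow> nat \<Rightarrow> complex" where
  "pq_poch ab p q n = (\<Prod>i<n. fst ab * p ^ i - snd ab * q ^ i)"

text \<open>The numbers of upper and lower parameters are the lengths of the lists. The exponent
  1 + s - r may be negative, hence the integer power.\<close>

definition basic_hyp_term ::
  "complex list \<Rightarrow> complex list \<Rightarrow> complex \<Rightarrow> complex \<Rightarrow> nat \<Rightarrow> complex" where
  "basic_hyp_term a b q z n =
     (\<Prod>x\<leftarrow>a. q_poch x q n) / ((\<Prod>y\<leftarrow>b. q_poch y q n) * q_poch q q n)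
     * ((-1) ^ n * q ^ (n * (n - 1) div 2)) powi (1 + int (length b) - int (length a))
     * z ^ n"

definition basic_hyp ::
  "complex list \<Rightarrow> complex list \<Rightarrow> complex \<Rightarrow> complex \<Rightarrow> complex" where
  "basic_hyp a b q z = (\<Sum>n. basic_hyp_term a b q z n)"

text \<open>A parameter pair has its \<open>p\<close>-component first and its \<open>q\<close>-component second.\<close>

definition twin_hyp_term ::
  "(complex \<times> complex) list \<Rightarrow> (complex \<times> complex) list
     \<Rightarrow> complex \<Rightarrow> complex \<Rightarrow> complex \<Rightarrow> nat \<Rightarrow> complex" where
  "twin_hyp_term a b p q z n =
     (\<Prod>x\<leftarrow>a. pq_poch x p q n) / ((\<Prod>y\<leftarrow>b. pq_poch y p q n) * pq_poch (p, q) p q n)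
     * ((-1) ^ n * (q / p) ^ (n * (n - 1) div 2)) powi (1 + int (length b) - int (length a))
     * z ^ n"

definition twin_hyp ::
  "(complex \<times> complex) list \<Rightarrow> (complex \<times> complex) list
     \<Rightarrow> complex \<Rightarrow> complex \<Rightarrow> complex \<Rightarrow> complex" where
  "twin_hyp a b p q z = (\<Sum>n. twin_hyp_term a b p q z n)"

end

theory Submission
  imports Defs
begin

text \<open>The identity holds term by term. Pulling \<open>u p\<^sup>i\<close> out of each factor \<open>u p\<^sup>i - v q\<^sup>i\<close> turns a
  twin-basic Pochhammer symbol into \<open>u\<^sup>n p\<^sup>T\<close> times the ordinary one with parameter \<open>v / u\<close> and base
  \<open>q / p\<close>, where \<open>T = n (n - 1) / 2\<close> (\<open>pq_poch_eq_q_poch\<close>). The factors \<open>u\<^sup>n\<close>, together with the \<open>p\<^sup>n\<close>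
  of the symbol of \<open>(p, q)\<close>, are cancelled by \<open>\<mu>\<^sup>n\<close>. What remains is \<open>p\<^sup>T\<close> to the power \<open>r - s - 1\<close>.

  The pair \<open>(0, 1)\<close> contributes \<open>(-1)\<^sup>n q\<^sup>T\<close> (\<open>pq_poch_zero_one\<close>). Inserting it until there is one
  upper parameter more than lower ones removes the explicit sign and power factor from the
  twin-basic series, and the inserted symbols combine with the power of \<open>p\<^sup>T\<close> to the factor
  \<open>((-1)\<^sup>n (q / p)\<^sup>T)\<close> to the power \<open>1 + s - r\<close> of the ordinary series.
  The three cases differ only in where the pairs are inserted, so that a single identity with
  insertions on both sides (\<open>twin_hyp_term_padded\<close>) covers all of them.\<close>

lemma prod_power_triangular:
  fixes x :: "'a::comm_monoid_mult"
  shows "(\<Prod>i<n. x ^ i) = x ^ (n * (n - 1) div 2)"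
proof -
  have "(\<Prod>i<n. x ^ i) = x ^ (\<Sum>i<n. i)"
    by (simp add: power_sum)
  also have "(\<Sum>i<n. i) = n * (n - 1) div 2"
    using Sum_Ico_nat[of 0 n] by (simp add: atLeast0LessThan)
  finally show ?thesis .
qed

lemma pq_poch_eq_q_poch:
  assumes "fst x \<noteq> 0" "P \<noteq> 0"
  shows "pq_poch x P Q n
    = fst x ^ n * P ^ (n * (n - 1) div 2) * q_poch (snd x / fst x) (Q / P) n"
proof -
  have "fst x * P ^ i - snd x * Q ^ i
      = fst x * P ^ i * (1 - snd x / fst x * (Q / P) ^ i)" for i
    using assms by (simp add: field_simps)
  then show ?thesis
    by (simp add: pq_poch_def q_poch_def prod.distrib prod_power_triangular)
qed

lemma pq_poch_zero_one: "pq_poch (0, 1) P Q n = (-1) ^ n * Q ^ (n * (n - 1) div 2)"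
proof -
  have "pq_poch (0, 1) P Q n = (\<Prod>i<n. (-1) * Q ^ i)"
    by (simp add: pq_poch_def)
  then show ?thesis
    by (simp only: prod.distrib prod_power_triangular prod_constant card_lessThan)
qed

lemma prod_list_pq_poch:
  assumes "\<forall>x\<in>set xs. fst x \<noteq> 0" "P \<noteq> 0"
  shows "(\<Prod>x\<leftarrow>xs. pq_poch x P Q n)
    = (\<Prod>x\<leftarrow>xs. fst x) ^ n * (P ^ (n * (n - 1) div 2)) ^ length xs
      * (\<Prod>x\<leftarrow>map (\<lambda>x. snd x / fst x) xs. q_poch x (Q / P) n)"
  using assms(1)
  by (induction xs) (simp_all add: pq_poch_eq_q_poch assms(2) power_mult_distrib mult_ac)

text \<open>The length condition says that the padded twin-basic series carries the exponent \<open>0\<close> on its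
  sign and power factor. Hence \<open>k - l = 1 + s - r\<close> is the exponent in the ordinary series.\<close>

lemma twin_hyp_term_padded:
  assumes "P \<noteq> 0" "Q \<noteq> 0"
    and a: "\<forall>x\<in>set a. fst x \<noteq> 0" and b: "\<forall>y\<in>set b. fst y \<noteq> 0"
    and len: "length a + k = Suc (length b + l)"
  shows "twin_hyp_term (a @ replicate k (0, 1)) (b @ replicate l (0, 1)) P Q
      ((\<Prod>y\<leftarrow>b. fst y) * P / (\<Prod>x\<leftarrow>a. fst x) * z) n
    = basic_hyp_term (map (\<lambda>x. snd x / fst x) a) (map (\<lambda>y. snd y / fst y) b) (Q / P) z n"
proof -
  define T where "T = n * (n - 1) div 2"
  define E where "E = P ^ T"
  define F where "F = (-1) ^ n * Q ^ T"
  define \<alpha> where "\<alpha> = (\<Prod>x\<leftarrow>a. fst x)"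
  define \<beta> where "\<beta> = (\<Prod>y\<leftarrow>b. fst y)"
  define A where "A = (\<Prod>x\<leftarrow>map (\<lambda>x. snd x / fst x) a. q_poch x (Q / P) n)"
  define B where "B = (\<Prod>y\<leftarrow>map (\<lambda>y. snd y / fst y) b. q_poch y (Q / P) n)"
  define D where "D = q_poch (Q / P) (Q / P) n"
  have nz: "E \<noteq> 0" "F \<noteq> 0" "\<alpha> \<noteq> 0" "\<beta> \<noteq> 0"
    using assms by (auto simp: E_def F_def \<alpha>_def \<beta>_def prod_list_zero_iff)
  have exponent: "1 + int (length b) - int (length a) = int k - int l"
    using len by linarith
  have padded_exponent:
    "1 + int (length (b @ replicate l (0::complex, 1::complex)))
      - int (length (a @ replicate k (0::complex, 1::complex))) = 0"
    using len by simp
  have upper: "(\<Prod>x\<leftarrow>a @ replicate k (0, 1). pq_poch x P Q n) = \<alpha> ^ n * E ^ length a * A * F ^ k"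
    by (simp add: prod_list_pq_poch[OF a \<open>P \<noteq> 0\<close>] pq_poch_zero_one prod_list_replicate
        A_def E_def F_def T_def \<alpha>_def)
  have lower: "(\<Prod>y\<leftarrow>b @ replicate l (0, 1). pq_poch y P Q n) = \<beta> ^ n * E ^ length b * B * F ^ l"
    by (simp add: prod_list_pq_poch[OF b \<open>P \<noteq> 0\<close>] pq_poch_zero_one prod_list_replicate
        B_def E_def F_def T_def \<beta>_def)
  have base: "pq_poch (P, Q) P Q n = P ^ n * E * D"
    using \<open>P \<noteq> 0\<close> by (simp add: pq_poch_eq_q_poch E_def D_def T_def)
  have powers: "E ^ length a * F ^ k / (E ^ length b * F ^ l * E) = (F / E) powi (int k - int l)"
  proof -
    have "E ^ length a * E ^ k = E ^ length b * E * E ^ l"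
      using len by (metis power_add power_Suc2 add_Suc)
    then show ?thesis
      using nz by (simp add: power_int_diff power_divide field_simps)
  qed
  have "twin_hyp_term (a @ replicate k (0, 1)) (b @ replicate l (0, 1)) P Q (\<beta> * P / \<alpha> * z) n
      = \<alpha> ^ n * E ^ length a * A * F ^ k / (\<beta> ^ n * E ^ length b * B * F ^ l * (P ^ n * E * D))
        * (\<beta> * P / \<alpha> * z) ^ n"
    using padded_exponent unfolding twin_hyp_term_def upper lower base
    by (simp only: power_int_0_right mult_1_right)
  also have "\<dots> = A / (B * D) * (E ^ length a * F ^ k / (E ^ length b * F ^ l * E)) * z ^ n"
    using nz \<open>P \<noteq> 0\<close> by (simp add: power_mult_distrib power_divide mult_ac)
  also have "\<dots> = A / (B * D) * (F / E) powi (int k - int l) * z ^ n"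
    by (simp only: powers)
  also have "\<dots> = basic_hyp_term (map (\<lambda>x. snd x / fst x) a) (map (\<lambda>y. snd y / fst y) b) (Q / P) z n"
    using exponent
    by (simp add: basic_hyp_term_def A_def B_def D_def E_def F_def T_def power_divide)
  finally show ?thesis
    by (simp add: \<alpha>_def \<beta>_def)
qed

theorem mainTheorem1:
  fixes p q :: real and r s :: nat
    and a b :: "(complex \<times> complex) list" and z \<mu> :: complex
  defines "P \<equiv> complex_of_real p" and "Q \<equiv> complex_of_real q"
  defines "a' \<equiv> map (\<lambda>x. snd x / fst x) a" and "b' \<equiv> map (\<lambda>y. snd y / fst y) b"
  assumes "0 < q" and "q < p"
    and "length a = r" and "length b = s"
    and "\<forall>x\<in>set a. fst x \<noteq> 0 \<and> snd x \<noteq> 0"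
    and "\<forall>y\<in>set b. fst y \<noteq> 0 \<and> snd y \<noteq> 0"
    and "\<forall>y\<in>set b. \<forall>k. fst y * P ^ k \<noteq> snd y * Q ^ k"
    and "norm z < 1"
    and "\<mu> = (\<Prod>y\<leftarrow>b. fst y) * P / (\<Prod>x\<leftarrow>a. fst x)"
    and "summable (basic_hyp_term a' b' (Q / P) z)
         \<or> (\<exists>N. \<forall>n\<ge>N. basic_hyp_term a' b' (Q / P) z n = 0)"
  shows "(int s = int r - 1 \<longrightarrow>
            summable (twin_hyp_term a b P Q (\<mu> * z)) \<and>
            basic_hyp a' b' (Q / P) z = twin_hyp a b P Q (\<mu> * z))
       \<and> (int s > int r - 1 \<longrightarrow>
            summable (twin_hyp_term (a @ replicate (s + 1 - r) (0, 1)) b P Q (\<mu> * z)) \<and>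
            basic_hyp a' b' (Q / P) z
              = twin_hyp (a @ replicate (s + 1 - r) (0, 1)) b P Q (\<mu> * z))
       \<and> (int s < int r - 1 \<longrightarrow>
            summable (twin_hyp_term a (b @ replicate (r - 1 - s) (0, 1)) P Q (\<mu> * z)) \<and>
            basic_hyp a' b' (Q / P) z
              = twin_hyp a (b @ replicate (r - 1 - s) (0, 1)) P Q (\<mu> * z))"
proof -
  have nz: "P \<noteq> 0" "Q \<noteq> 0" "\<forall>x\<in>set a. fst x \<noteq> 0" "\<forall>y\<in>set b. fst y \<noteq> 0"
    using assms by auto
  have convergent: "summable (basic_hyp_term a' b' (Q / P) z)"
    using assms(14)
  proof
    assume "\<exists>N. \<forall>n\<ge>N. basic_hyp_term a' b' (Q / P) z n = 0"
    then obtain N where "\<forall>n\<ge>N. basic_hyp_term a' b' (Q / P) z n = 0" ..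
    then show ?thesis
      by (intro summable_finite[of "{..<N}"]) (auto simp: not_less)
  qed
  have padded: "summable (twin_hyp_term (a @ replicate k (0, 1)) (b @ replicate l (0, 1)) P Q (\<mu> * z))
      \<and> basic_hyp a' b' (Q / P) z
        = twin_hyp (a @ replicate k (0, 1)) (b @ replicate l (0, 1)) P Q (\<mu> * z)"
    if "r + k = Suc (s + l)" for k l
  proof -
    have "twin_hyp_term (a @ replicate k (0, 1)) (b @ replicate l (0, 1)) P Q (\<mu> * z)
        = basic_hyp_term a' b' (Q / P) z"
      unfolding assms(13) a'_def b'_def
      using twin_hyp_term_padded[OF nz] that assms(7,8) by blast
    then show ?thesis
      using convergent by (simp add: basic_hyp_def twin_hyp_def)
  qed
  show ?thesis
    using padded[of 0 0] padded[of "s + 1 - r" 0] padded[of 0 "r - 1 - s"] by auto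
qed

end
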